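(* Let $F$ be an algebraically closed field, let $A$ be an $n \times n$ matrix over $F$, and let $q(t) \in F[t]$ be a monic polynomial of degree $n$. Then there exists a rank one matrix $B$ (of size $n\times n$ over $F$) such that \[ p_{A+B}(t)=q(t) \] if and only if for all $\lambda \in F$ the following condition is satisfied: \[ m_{\lambda}(q) \geq \operatorname{alg}_{\lambda}(A)-j_{\lambda}(A). \]
   Context: For a square matrix $M$ over $F$, $p_M(t)=\det(tI-M)$ denotes its characteristic polynomial. For $\lambda\in F$ and a polynomial $f(t)\in F[t]$, $m_\lambda(f)$ denotes the multiplicity of $(t-\lambda)$ in $f(t)$. The algebraic multiplicity of $\lambda$ as an eigenvalue of $A$ is $\operatorname{alg}_\lambda(A)=m_\lambda(p_A(t))$. The integer $j_\lambda(A)$ is the size of the largest Jordan block in $A$ (i.e. in its Jordan normal form) with $\lambda$ on the main diagonal, read as $0$ if there is no such block.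
   Formalization: Assumes n ≥ 1 and, when n = 1, that q ≠ p_A: for n = 1 and q = p_A the multiplicity condition holds, but p_{A+B} = q forces B = 0, which is not of rank one; for n = 0 no rank one matrix exists. *)

theory Defs
  imports
    "Jordan_Normal_Form.Jordan_Normal_Form_Uniqueness"
    "Jordan_Normal_Form.DL_Rank"
begin

definition alg_mult :: "'a::field \<Rightarrow> 'a mat \<Rightarrow> nat" where
  "alg_mult \<mu> A = Polynomial.order \<mu> (char_poly A)"

text \<open>A list \<open>n_as\<close> with \<open>jordan_nf A n_as\<close> consists of the pairs (block size, diagonal entry) of
  a Jordan normal form of \<open>A\<close>. By \<open>jordan_nf_unique\<close> the set of these pairs depends on \<open>A\<close> only;
  the inserted 0 covers the case that no block belongs to \<open>\<mu>\<close>.\<close>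

definition max_jordan_block :: "'a::field \<Rightarrow> 'a mat \<Rightarrow> nat" where
  "max_jordan_block \<mu> A = Max (insert 0 {k. \<exists>n_as. jordan_nf A n_as \<and> (k, \<mu>) \<in> set n_as})"

lemma max_jordan_block_eq:
  assumes "jordan_nf A n_as"
  shows "max_jordan_block \<mu> A = Max (insert 0 {k. (k, \<mu>) \<in> set n_as})"
proof -
  have "{k. \<exists>m_bs. jordan_nf A m_bs \<and> (k, \<mu>) \<in> set m_bs} = {k. (k, \<mu>) \<in> set n_as}"
    using assms by (blast dest: jordan_nf_unique)
  then show ?thesis by (simp add: max_jordan_block_def)
qed

text \<open>For 1 by 1 matrices and \<open>q = char_poly A\<close>, the equation \<open>char_poly (A + B) = q\<close> forces \<open>B = 0\<close>,
  which has rank 0, although the multiplicity condition holds. So an equivalence in terms of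
  matrices \<open>B\<close> of rank exactly 1 has to exclude this case. No other case with
  \<open>n \<ge> 1\<close> is degenerate.\<close>

end

theory Submission
  imports Defs "Jordan_Normal_Form.Jordan_Normal_Form_Existence"
begin

text \<open>Write a matrix of rank one as \<open>u v\<close> with a column \<open>u\<close> and a row \<open>v\<close>, and let \<open>p\<close> and \<open>p'\<close> be the
characteristic polynomials of \<open>A\<close> and \<open>A + u v\<close>. Everything rests on one identity: if a column
\<open>w\<close> of polynomials solves \<open>(t I - A) w = d u\<close> for some polynomial \<open>d\<close>, then
\<open>d p' = p (d - v w)\<close> (lemma \<open>char_poly_rank_one_perturbation\<close>). It is
the matrix determinant lemma with the denominator \<open>d\<close> of the resolvent cleared. The denominator
to use is the minimal polynomial of \<open>A\<close>, the product \<open>d\<close> of the powers of \<open>t - \<lambda>\<close> with exponents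
\<open>j\<^sub>\<lambda>\<close>. Both sides of the equivalence are invariant under similarity, so \<open>A\<close> may be taken to be a
Jordan matrix \<open>J\<close>.

Necessity: \<open>d\<close> clears the denominators in the resolvents of all blocks, so
\<open>(t I - J) W = d I\<close> for a polynomial matrix \<open>W\<close>, and
\<open>w = W u\<close> solves the equation for every \<open>u\<close>. Hence \<open>p\<close> divides \<open>d q\<close>, and comparing
multiplicities at \<open>\<lambda>\<close> gives \<open>alg\<^sub>\<lambda> \<le> j\<^sub>\<lambda> + m\<^sub>\<lambda>(q)\<close>.

Sufficiency: let \<open>u\<close> be 1 in the last position of every block and 0 elsewhere. Then the entries
of \<open>w\<close> are the quotients \<open>d / (t - \<lambda>)\<^sup>i\<close> with \<open>1 \<le> i \<le> k\<close>, for \<open>k\<close> running through the sizes of the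
blocks for \<open>\<lambda>\<close>. As \<open>k = j\<^sub>\<lambda>\<close> occurs, these are all proper partial fractions with denominator
\<open>d\<close>, cleared of the denominator, and so \<open>v w\<close> can be any polynomial of degree less than that of \<open>d\<close>
(lemma \<open>partial_fractions_span\<close>). The multiplicity condition says that \<open>p / d\<close> divides
\<open>q\<close>; if \<open>q = (p / d) g\<close>, choosing \<open>v w = d - g\<close> makes the new characteristic polynomial
equal to \<open>q\<close>. If \<open>q \<noteq> p\<close>, the perturbation is not zero and thus has rank one. If \<open>q = p\<close>, this
choice asks for \<open>v w = 0\<close> and may give \<open>v = 0\<close>; instead, an additional entry above the diagonal
of the triangular matrix \<open>J\<close> is a perturbation of rank one that does not change \<open>p\<close>. It needs
\<open>n \<ge> 2\<close>, which the exclusion of the case \<open>n = 1\<close>, \<open>q = p\<close> provides.\<close>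

section \<open>Jordan normal forms over algebraically closed fields\<close>

text \<open>Completes an eigenvector to a basis, for the change of basis that splits off one eigenvalue.\<close>

lemma invertible_with_first_column:
  fixes v :: "'a :: field vec"
  assumes v: "v \<in> carrier_vec n" "v \<noteq> 0\<^sub>v n"
  shows "\<exists>W W'. W \<in> carrier_mat n n \<and> W' \<in> carrier_mat n n \<and> W * W' = 1\<^sub>m n \<and> W' * W = 1\<^sub>m n \<and> col W 0 = v"
proof -
  interpret vec_space "TYPE('a)" n .
  note b = basis_completion[OF v]
  define W where "W = mat_of_cols n (basis_completion v)"
  have W: "W \<in> carrier_mat n n" unfolding W_def using b(6) mat_of_cols_carrier(1) by metis
  have cols: "cols W = basis_completion v" unfolding W_def using b(2) by simp
  have "rank W = n" using lin_indpt_full_rank[OF W] b(4,5) cols by simp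
  hence "det W \<noteq> 0" using det_rank_iff[OF W] by simp
  from det_non_zero_imp_unit[OF W this] obtain W' where
    W': "W' \<in> carrier_mat n n" "W * W' = 1\<^sub>m n" "W' * W = 1\<^sub>m n"
    unfolding Units_def ring_mat_def by auto
  have "n \<noteq> 0" using v by auto
  hence "col W 0 = v" using b(6,7) cols W
    by (metis cols_length cols_nth hd_conv_nth length_0_conv neq0_conv carrier_matD(2))
  thus ?thesis using W W' by blast
qed

text \<open>Triangularization by induction on the size: in a basis that starts with an eigenvector, the first
column is zero below the diagonal, and the remaining diagonal block is triangularized by the
induction hypothesis.\<close>

lemma similar_upper_triangular:
  fixes A :: "'a :: alg_closed_field mat"
  assumes "A \<in> carrier_mat n n"
  shows "\<exists>B \<in> carrier_mat n n. upper_triangular B \<and> similar_mat A B"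
  using assms
proof (induction n arbitrary: A)
  case 0
  thus ?case by (intro bexI[of _ A]) (auto simp: similar_mat_refl)
next
  case (Suc m)
  note A = Suc.prems
  have "degree (char_poly A) > 0" using degree_monic_char_poly[OF A] by simp
  then obtain e where "poly (char_poly A) e = 0" using alg_closed_imp_poly_has_root by blast
  then obtain v where "eigenvector A v e"
    using eigenvalue_root_char_poly[OF A] unfolding eigenvalue_def by blast
  hence v: "v \<in> carrier_vec (Suc m)" "v \<noteq> 0\<^sub>v (Suc m)" and eig: "A *\<^sub>v v = e \<cdot>\<^sub>v v"
    using A unfolding eigenvector_def by auto
  obtain W W' where W: "W \<in> carrier_mat (Suc m) (Suc m)" and W': "W' \<in> carrier_mat (Suc m) (Suc m)"
    and inv: "W * W' = 1\<^sub>m (Suc m)" "W' * W = 1\<^sub>m (Suc m)" and col0: "col W 0 = v"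
    using invertible_with_first_column[OF v] by blast
  define C where "C = W' * A * W"
  have C: "C \<in> carrier_mat (Suc m) (Suc m)" unfolding C_def using W W' A by simp
  have "similar_mat C A"
    by (rule similar_matI[of _ _ W' W "Suc m"]) (use A C W W' inv in \<open>auto simp: C_def\<close>)
  hence AC: "similar_mat A C" by (rule similar_mat_sym)
  have "col C 0 = W' *\<^sub>v (A *\<^sub>v col W 0)"
  proof -
    have "col C 0 = col (W' * (A * W)) 0" unfolding C_def using A W W' by simp
    also have "\<dots> = W' *\<^sub>v col (A * W) 0" using A W W' by (intro col_mult2) auto
    also have "col (A * W) 0 = A *\<^sub>v col W 0" using A W by (intro col_mult2) auto
    finally show ?thesis .
  qed
  also have "\<dots> = e \<cdot>\<^sub>v (W' *\<^sub>v col W 0)"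
    unfolding col0 eig using W' v by (simp add: mult_mat_vec)
  also have "W' *\<^sub>v col W 0 = col (W' * W) 0" using W W' by (subst col_mult2) auto
  also have "\<dots> = unit_vec (Suc m) 0" unfolding inv by simp
  finally have C0: "col C 0 = e \<cdot>\<^sub>v unit_vec (Suc m) 0" .
  obtain C1 C2 C0' C3 where split: "split_block C 1 1 = (C1, C2, C0', C3)"
    by (cases "split_block C 1 1") auto
  have blocks: "C1 \<in> carrier_mat 1 1" "C2 \<in> carrier_mat 1 m" "C0' \<in> carrier_mat m 1"
    "C3 \<in> carrier_mat m m" "C = four_block_mat C1 C2 C0' C3"
    using split_block[OF split, of m m] C by auto
  have "C0' = 0\<^sub>m m 1"
  proof (rule eq_matI)
    fix i j assume ij: "i < dim_row (0\<^sub>m m 1 :: 'a mat)" "j < dim_col (0\<^sub>m m 1 :: 'a mat)"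
    hence "C $$ (Suc i, 0) = C0' $$ (i, j)" using blocks by simp
    moreover have "C $$ (Suc i, 0) = col C 0 $ Suc i" using C ij by simp
    ultimately show "C0' $$ (i, j) = 0\<^sub>m m 1 $$ (i, j)" using C0 ij by simp
  qed (use blocks in auto)
  with blocks have Cb: "C = four_block_mat C1 C2 (0\<^sub>m m 1) C3" by simp
  obtain B3 where B3: "B3 \<in> carrier_mat m m" "upper_triangular B3" "similar_mat C3 B3"
    using Suc.IH[OF blocks(4)] by blast
  obtain B2 where B2: "B2 \<in> carrier_mat 1 m"
    "similar_mat C (four_block_mat C1 B2 (0\<^sub>m m 1) B3)"
    using similar_mat_four_block_0_ex[OF similar_mat_refl[OF blocks(1)] B3(3) blocks(2,1,4)]
    unfolding Cb by blast
  show ?case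
  proof (intro bexI conjI)
    show "similar_mat A (four_block_mat C1 B2 (0\<^sub>m m 1) B3)"
      using similar_mat_trans[OF AC B2(2)] .
    show "upper_triangular (four_block_mat C1 B2 (0\<^sub>m m 1) B3)"
      by (rule upper_triangular_four_block) (use blocks B3 in auto)
    show "four_block_mat C1 B2 (0\<^sub>m m 1) B3 \<in> carrier_mat (Suc m) (Suc m)"
      using four_block_carrier_mat[OF blocks(1) B3(1)] by simp
  qed
qed

lemma jordan_nf_exists_alg_closed:
  fixes A :: "'a :: alg_closed_field mat"
  assumes "A \<in> carrier_mat n n"
  shows "\<exists>n_as. jordan_nf A n_as"
proof -
  obtain B where B: "B \<in> carrier_mat n n" "upper_triangular B" "similar_mat A B"
    using similar_upper_triangular[OF assms] by blast
  from triangular_to_jnf_vector[OF B(1,2)] similar_mat_trans[OF B(3)]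
  show ?thesis unfolding jordan_nf_def by blast
qed

section \<open>Matrices of rank one\<close>

lemma (in vec_space) span_single:
  assumes c: "c \<in> carrier_vec n" and x: "x \<in> span {c}"
  shows "\<exists>a. x = a \<cdot>\<^sub>v c"
proof -
  obtain a where a: "x = lincomb a {c}" using x finite_span[of "{c}"] c by auto
  have "x = a c \<cdot>\<^sub>v c"
  proof (rule eq_vecI)
    have "dim_vec x = n" unfolding a using c by (intro lincomb_dim) auto
    thus "dim_vec x = dim_vec (a c \<cdot>\<^sub>v c)" using c by simp
    fix i assume "i < dim_vec (a c \<cdot>\<^sub>v c)"
    thus "x $ i = (a c \<cdot>\<^sub>v c) $ i" unfolding a using c lincomb_index[of i "{c}" a] by simp
  qed
  thus ?thesis ..
qed

lemma (in vec_space) lin_indpt_single: "c \<in> carrier_vec n \<Longrightarrow> c \<noteq> 0\<^sub>v n \<Longrightarrow> lin_indpt {c}"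
  using lin_dep_iff_in_span[of "{}" c] span_empty by (auto simp: lin_dep_def)

lemma nonzero_mat_has_nonzero_col:
  fixes B :: "'a :: zero mat"
  assumes B: "B \<in> carrier_mat n m" and B0: "B \<noteq> 0\<^sub>m n m"
  shows "\<exists>j < m. col B j \<noteq> 0\<^sub>v n"
proof (rule ccontr)
  assume "\<not> ?thesis"
  hence "col B j = 0\<^sub>v n" if "j < m" for j using that by blast
  hence "col B j $ i = 0" if "i < n" "j < m" for i j using that by simp
  hence "B = 0\<^sub>m n m" using B by (intro eq_matI) auto
  with B0 show False ..
qed

text \<open>The rank is defined as the dimension of the column span. The factorization into a column and a row
is the form in which matrices of rank one enter all computations below.\<close>

lemma rank_eq_1_iff:
  fixes B :: "'a :: field mat"
  assumes B: "B \<in> carrier_mat n m"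
  shows "vec_space.rank n B = 1 \<longleftrightarrow>
    B \<noteq> 0\<^sub>m n m \<and> (\<exists>u \<in> carrier_mat n 1. \<exists>v \<in> carrier_mat 1 m. B = u * v)"
proof -
  interpret vec_space "TYPE('a)" n .
  have cols: "set (cols B) \<subseteq> carrier_vec n" using cols_dim B by blast
  show ?thesis
  proof (intro iffI conjI; (elim conjE)?)
    assume r: "rank B = 1"
    show "B \<noteq> 0\<^sub>m n m" using r rank_0I by auto
    then obtain j where j: "j < m" "col B j \<noteq> 0\<^sub>v n"
      using nonzero_mat_has_nonzero_col[OF B] by blast
    define c where "c = col B j"
    have mem: "col B k \<in> carrier_vec n" "col B k \<in> set (cols B)" if "k < m" for k
      using B that unfolding cols_def by (auto intro!: image_eqI[of _ _ k])
    have c: "c \<in> carrier_vec n" "c \<noteq> 0\<^sub>v n" "c \<in> set (cols B)"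
      unfolding c_def using mem[OF j(1)] j(2) by auto
    have "\<exists>a. col B k = a \<cdot>\<^sub>v c" if k: "k < m" for k
    proof (cases "col B k = c")
      case True
      thus ?thesis by (intro exI[of _ 1]) simp
    next
      case False
      note x = mem[OF k]
      have "card ({c} \<union> {col B k}) = 2" using False by simp
      hence "lin_dep ({c} \<union> {col B k})"
        using rank_ge_card_indpt[OF B, of "{c} \<union> {col B k}"] r c x by auto
      hence "col B k \<in> span {c}"
        using lin_dep_iff_in_span[of "{c}" "col B k"] lin_indpt_single c x False by simp
      thus ?thesis using span_single[OF c(1)] by blast
    qed
    then obtain a where a: "\<And>k. k < m \<Longrightarrow> col B k = a k \<cdot>\<^sub>v c" by metis
    show "\<exists>u \<in> carrier_mat n 1. \<exists>v \<in> carrier_mat 1 m. B = u * v"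
    proof (intro bexI)
      show "B = mat_of_cols n [c] * mat 1 m (\<lambda>(i, k). a k)"
      proof (rule eq_matI)
        fix r k assume "r < dim_row (mat_of_cols n [c] * mat 1 m (\<lambda>(i, k). a k))"
          "k < dim_col (mat_of_cols n [c] * mat 1 m (\<lambda>(i, k). a k))"
        hence rk: "r < n" "k < m" by auto
        have "B $$ (r, k) = col B k $ r" using B rk by simp
        also have "\<dots> = a k * c $ r" using a[OF rk(2)] c rk by simp
        also have "\<dots> = (mat_of_cols n [c] * mat 1 m (\<lambda>(i, k). a k)) $$ (r, k)"
          using rk by (simp add: scalar_prod_def mat_of_cols_def)
        finally show "B $$ (r, k) = (mat_of_cols n [c] * mat 1 m (\<lambda>(i, k). a k)) $$ (r, k)" .
      qed (use B in auto)
    qed auto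
  next
    assume B0: "B \<noteq> 0\<^sub>m n m" and "\<exists>u \<in> carrier_mat n 1. \<exists>v \<in> carrier_mat 1 m. B = u * v"
    then obtain u v where uv: "u \<in> carrier_mat n 1" "v \<in> carrier_mat 1 m" "B = u * v" by blast
    have le: "rank B \<le> 1"
      by (rule rank_le_1_product_entries[OF B, of "\<lambda>i. u $$ (i, 0)" "\<lambda>j. v $$ (0, j)"])
        (use uv in \<open>auto simp: scalar_prod_def\<close>)
    obtain j where j: "j < m" "col B j \<noteq> 0\<^sub>v n"
      using nonzero_mat_has_nonzero_col[OF B B0] by blast
    moreover have "col B j \<in> carrier_vec n" "col B j \<in> set (cols B)"
      using B j(1) unfolding cols_def by (auto intro!: image_eqI[of _ _ j])
    ultimately have "rank B \<ge> 1" using rank_ge_card_indpt[OF B, of "{col B j}"] lin_indpt_single by simp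
    with le show "rank B = 1" by simp
  qed
qed

text \<open>Conjugation carries perturbations of rank one of a matrix to those of any similar matrix, so the set of
attainable characteristic polynomials depends on the Jordan normal form only.\<close>

lemma rank_one_perturbation_similar:
  fixes A C :: "'a :: field mat"
  assumes A: "A \<in> carrier_mat n n" and sim: "similar_mat A C"
    and B: "B \<in> carrier_mat n n" "vec_space.rank n B = 1"
  shows "\<exists>B' \<in> carrier_mat n n. vec_space.rank n B' = 1 \<and> char_poly (C + B') = char_poly (A + B)"
proof -
  obtain P Q where wit: "similar_mat_wit A C P Q" using sim unfolding similar_mat_def by blast
  note PQ = similar_mat_witD2[OF A wit]
  from B(2)[unfolded rank_eq_1_iff[OF B(1)]]
  obtain u v where uv: "u \<in> carrier_mat n 1" "v \<in> carrier_mat 1 n" "B = u * v" and B0: "B \<noteq> 0\<^sub>m n n"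
    by blast
  define B' where "B' = Q * B * P"
  have B': "B' \<in> carrier_mat n n" unfolding B'_def using PQ(4-) B by simp
  have conj_back: "P * B' * Q = B"
  proof -
    have "P * B' * Q = P * (Q * B) * P * Q" unfolding B'_def
      using PQ(4-) B(1) by (subst assoc_mult_mat[of P n n "Q * B" n P n]) auto
    also have "\<dots> = P * Q * B * P * Q"
      using PQ(4-) B(1) by (subst assoc_mult_mat[of P n n Q n B n]) auto
    also have "\<dots> = P * Q * B * (P * Q)"
      using PQ(4-) B(1) by (subst assoc_mult_mat[of _ n n P n Q n]) auto
    finally show ?thesis using PQ(1) B(1) by simp
  qed
  have "B' \<noteq> 0\<^sub>m n n" 
  proof
    assume "B' = 0\<^sub>m n n"
    hence "P * B' * Q = 0\<^sub>m n n" using PQ(6,7) by simp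
    thus False using conj_back B0 by simp
  qed
  moreover have "B' = (Q * u) * (v * P)"
  proof -
    have "B' = Q * u * v * P" unfolding B'_def uv(3)
      using PQ(4-) uv(1,2) by (subst assoc_mult_mat[of Q n n u 1 v n]) auto
    also have "\<dots> = Q * u * (v * P)"
      using PQ(4-) uv(1,2) by (subst assoc_mult_mat[of "Q * u" n 1 v n P n]) auto
    finally show ?thesis .
  qed
  moreover have "Q * u \<in> carrier_mat n 1" "v * P \<in> carrier_mat 1 n" using PQ(6,7) uv(1,2) by auto
  ultimately have rank: "vec_space.rank n B' = 1" unfolding rank_eq_1_iff[OF B'] by blast
  have AB: "A + B = P * (C + B') * Q"
  proof -
    have "P * (C + B') * Q = P * C * Q + P * B' * Q"
      using PQ(4-) B'
      by (subst mult_add_distrib_mat[of P n n C n B'], simp, simp, simp)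
        (subst add_mult_distrib_mat[of "P * C" n n "P * B'" Q n], auto)
    thus ?thesis unfolding conj_back PQ(3)[symmetric] by simp
  qed
  have "similar_mat (A + B) (C + B')"
    by (rule similar_matI[OF _ PQ(1,2) AB]) (use A B(1) B' PQ(4-) in auto)
  hence char: "char_poly (C + B') = char_poly (A + B)" by (simp add: char_poly_similar)
  show ?thesis using B' rank char by blast
qed

section \<open>Characteristic polynomials of rank one perturbations\<close>

text \<open>The matrix determinant lemma without an inverse of \<open>M\<close>. The matrix with blocks \<open>M\<close>, \<open>u\<close>, \<open>v\<close>
and 1 has determinant \<open>det (M - u v)\<close> by block elimination of \<open>u\<close>. Replacing its
last column by \<open>d\<close> times that column minus the combination of the others with coefficients \<open>w\<close>
clears \<open>u\<close> in another way, by \<open>M w = d u\<close>, and multiplies the determinant by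
\<open>d\<close>. Both eliminations leave triangular block matrices.\<close>

lemma det_minus_rank_one:
  fixes M :: "'a :: idom mat"
  assumes M: "M \<in> carrier_mat n n" and u: "u \<in> carrier_mat n 1" and v: "v \<in> carrier_mat 1 n"
    and w: "w \<in> carrier_mat n 1" and Mw: "M * w = d \<cdot>\<^sub>m u"
  shows "d * det (M - u * v) = det M * (d - (v * w) $$ (0, 0))"
proof -
  define X where "X = four_block_mat M u v (1\<^sub>m 1)"
  have X: "X \<in> carrier_mat (n + 1) (n + 1)" unfolding X_def by (rule four_block_carrier_mat) (use M in auto)
  let ?L = "four_block_mat (1\<^sub>m n) u (0\<^sub>m 1 n) (1\<^sub>m 1)"
  let ?R = "four_block_mat (M - u * v) (0\<^sub>m n 1) v (1\<^sub>m 1)"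
  let ?Y = "four_block_mat (1\<^sub>m n) (- w) (0\<^sub>m 1 n) (d \<cdot>\<^sub>m 1\<^sub>m 1)"
  let ?Z = "four_block_mat M (0\<^sub>m n 1) v (d \<cdot>\<^sub>m 1\<^sub>m 1 - v * w)"
  have uv: "u * v \<in> carrier_mat n n" and Muv: "M - u * v \<in> carrier_mat n n" and vw: "v * w \<in> carrier_mat 1 1" using M u v w by auto
  have "?L * ?R = four_block_mat (1\<^sub>m n * (M - u * v) + u * v) (1\<^sub>m n * 0\<^sub>m n 1 + u * 1\<^sub>m 1)
      (0\<^sub>m 1 n * (M - u * v) + 1\<^sub>m 1 * v) (0\<^sub>m 1 n * 0\<^sub>m n 1 + 1\<^sub>m 1 * 1\<^sub>m 1)"
    by (rule mult_four_block_mat) (use M u v uv in auto)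
  also have "\<dots> = X" unfolding X_def
    by (rule cong_four_block_mat) (use M u v uv in \<open>auto simp: left_mult_zero_mat\<close>)
  finally have "X = ?L * ?R" by simp
  moreover have "?L \<in> carrier_mat (n + 1) (n + 1)" "?R \<in> carrier_mat (n + 1) (n + 1)"
    using M u v by auto
  ultimately have "det X = det ?L * det ?R" by (simp add: det_mult)
  also have "det ?L = 1" using det_four_block_mat_lower_left_zero[OF one_carrier_mat u refl one_carrier_mat] by simp
  also have "det ?R = det (M - u * v)"
    using det_four_block_mat_upper_right_zero[OF Muv refl v one_carrier_mat] by simp
  finally have 1: "det X = det (M - u * v)" by simp
  have "X * ?Y = four_block_mat (M * 1\<^sub>m n + u * 0\<^sub>m 1 n) (M * (- w) + u * (d \<cdot>\<^sub>m 1\<^sub>m 1))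
      (v * 1\<^sub>m n + 1\<^sub>m 1 * 0\<^sub>m 1 n) (v * (- w) + 1\<^sub>m 1 * (d \<cdot>\<^sub>m 1\<^sub>m 1))"
    unfolding X_def by (rule mult_four_block_mat) (use M u v w in auto)
  also have "\<dots> = ?Z"
  proof (rule cong_four_block_mat)
    show "M * (- w) + u * (d \<cdot>\<^sub>m 1\<^sub>m 1) = 0\<^sub>m n 1"
      using M u w Mw by (auto intro!: eq_matI simp: mult_smult_distrib[OF u one_carrier_mat])
    show "v * (- w) + 1\<^sub>m 1 * (d \<cdot>\<^sub>m 1\<^sub>m 1) = d \<cdot>\<^sub>m 1\<^sub>m 1 - v * w"
      using v w by (auto intro!: eq_matI)
  qed (use M u v in \<open>auto simp: right_mult_zero_mat\<close>)
  finally have "det (X * ?Y) = det ?Z" by simp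
  moreover have "?Y \<in> carrier_mat (n + 1) (n + 1)" using w by auto
  hence "det (X * ?Y) = det X * det ?Y" using X by (simp add: det_mult)
  moreover have "det ?Y = d"
    using det_four_block_mat_lower_left_zero[of "1\<^sub>m n" n "- w" 1 "0\<^sub>m 1 n" "d \<cdot>\<^sub>m 1\<^sub>m 1"] w
    by (simp add: det_single)
  moreover have "d \<cdot>\<^sub>m 1\<^sub>m 1 - v * w \<in> carrier_mat 1 1"
    using minus_carrier_mat[OF vw] .
  hence "det ?Z = det M * det (d \<cdot>\<^sub>m 1\<^sub>m 1 - v * w)"
    by (rule det_four_block_mat_upper_right_zero[OF M refl v])
  moreover have "det (d \<cdot>\<^sub>m 1\<^sub>m 1 - v * w) = d - (v * w) $$ (0, 0)"
    using v w by (subst det_single) auto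
  ultimately show ?thesis using 1 by (simp add: mult.commute)
qed

text \<open>Here \<open>w\<close> is \<open>d\<close> times the image of \<open>u\<close> under the resolvent of \<open>A\<close>.\<close>

lemma char_poly_rank_one_perturbation:
  fixes A :: "'a :: idom mat"
  assumes A: "A \<in> carrier_mat n n" and u: "u \<in> carrier_mat n 1" and v: "v \<in> carrier_mat 1 n"
    and w: "w \<in> carrier_mat n 1"
    and Mw: "char_poly_matrix A * w = d \<cdot>\<^sub>m map_mat (\<lambda>c. [:c:]) u"
  shows "d * char_poly (A + u * v) = char_poly A * (d - (map_mat (\<lambda>c. [:c:]) v * w) $$ (0, 0))"
proof -
  have "char_poly_matrix (A + u * v) =
    char_poly_matrix A - map_mat (\<lambda>c. [:c:]) u * map_mat (\<lambda>c. [:c:]) v"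
    using A u v by (intro eq_matI) (auto simp: char_poly_matrix_def scalar_prod_def)
  thus ?thesis unfolding char_poly_def
    using det_minus_rank_one[of "char_poly_matrix A" n "map_mat (\<lambda>c. [:c:]) u" "map_mat (\<lambda>c. [:c:]) v" w d]
      A u v w Mw by simp
qed

section \<open>Divisibility and partial fractions\<close>

text \<open>Common roots are cancelled one at a time.\<close>

lemma dvd_if_order_le:
  fixes f g :: "'a :: alg_closed_field poly"
  assumes "f \<noteq> 0" and "\<And>a. Polynomial.order a f \<le> Polynomial.order a g"
  shows "f dvd g"
  using assms
proof (induction "degree f" arbitrary: f g)
  case 0
  then obtain c where "f = [:c:]" "c \<noteq> 0" by (metis degree_eq_zeroE pCons_0_0)
  thus ?case by (simp add: const_poly_dvd_iff dvd_field_iff)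
next
  case (Suc k)
  show ?case
  proof (cases "g = 0")
    case False
    obtain a where a: "poly f a = 0" using alg_closed_imp_poly_has_root[of f] Suc.hyps(2) by force
    hence "Polynomial.order a g \<noteq> 0" using Suc.prems order_root[of f a] by (metis le_zero_eq)
    hence "poly g a = 0" by (simp add: order_root)
    then obtain f' g' where f: "f = [:-a, 1:] * f'" and g: "g = [:-a, 1:] * g'"
      using a by (metis poly_eq_0_iff_dvd dvdE)
    have nz: "f' \<noteq> 0" "g' \<noteq> 0" using f g Suc.prems(1) False by auto
    have "degree f = Suc (degree f')" unfolding f using nz by (subst degree_mult_eq) auto
    moreover have "Polynomial.order b f' \<le> Polynomial.order b g'" for b
      using Suc.prems(2)[of b] nz unfolding f g by (simp add: order_mult del: mult_pCons_left)
    ultimately have "f' dvd g'" using Suc.hyps nz by simp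
    thus ?thesis unfolding f g by (rule mult_dvd_mono[OF dvd_refl])
  qed simp
qed

text \<open>Partial fraction decomposition with the denominator \<open>d\<close> cleared: the quotients of \<open>d\<close> by powers of
linear factors span all polynomials of smaller degree. The induction removes one factor
\<open>t - a\<close> from \<open>d\<close>. The quotient \<open>M\<close> of \<open>d\<close> by the full power of \<open>t - a\<close> does not
vanish at \<open>a\<close>, so subtracting a multiple of it from \<open>N\<close> leaves a polynomial \<open>(t - a) N'\<close>. Now the
induction hypothesis applies to \<open>N'\<close>, \<open>d / (t - a)\<close> and the space of all \<open>f\<close> with
\<open>(t - a) f \<in> L\<close>. Letting the space \<open>L\<close> vary is what makes this induction go through
without any bookkeeping of the individual exponents.\<close>

lemma partial_fractions_span:
  fixes d :: "'a :: alg_closed_field poly"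
  assumes "d \<noteq> 0"
    and "0 \<in> L"
    and "\<And>f g. f \<in> L \<Longrightarrow> g \<in> L \<Longrightarrow> f + g \<in> L"
    and "\<And>c f. f \<in> L \<Longrightarrow> Polynomial.smult c f \<in> L"
    and "\<And>a i f. d = [:-a, 1:] ^ i * f \<Longrightarrow> i > 0 \<Longrightarrow> f \<in> L"
    and "N = 0 \<or> degree N < degree d"
  shows "N \<in> L"
  using assms
proof (induction "degree d" arbitrary: d L N)
  case 0
  thus ?case by auto
next
  case (Suc k)
  note L = Suc.prems(2-5)
  obtain a where "poly d a = 0" using alg_closed_imp_poly_has_root[of d] Suc.hyps(2) by force
  hence ord: "Polynomial.order a d > 0" using Suc.prems(1) order_root by blast
  obtain M where M: "d = [:-a, 1:] ^ Polynomial.order a d * M" "\<not> [:-a, 1:] dvd M"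
    using order_decomp[OF Suc.prems(1)] by blast
  hence Ma: "poly M a \<noteq> 0" by (simp add: poly_eq_0_iff_dvd)
  have M_in_L: "M \<in> L" using L(4)[OF M(1) ord] .
  define d' where "d' = [:-a, 1:] ^ (Polynomial.order a d - 1) * M"
  have d: "d = [:-a, 1:] * d'" unfolding d'_def using M(1) ord
    by (metis Suc_diff_1 mult.assoc power_Suc)
  have d'0: "d' \<noteq> 0" using d Suc.prems(1) by auto
  have degd: "degree d = Suc (degree d')" unfolding d using d'0 by (subst degree_mult_eq) auto
  have "degree M \<le> degree d'" unfolding d'_def using d'0 d'_def
    by (metis degree_mult_right_le mult.commute mult_zero_right)
  define c where "c = poly N a / poly M a"
  have "poly (N - Polynomial.smult c M) a = 0" using Ma by (simp add: c_def)
  then obtain N' where N': "N - Polynomial.smult c M = [:-a, 1:] * N'" by (metis poly_eq_0_iff_dvd dvdE)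
  have degN': "N' = 0 \<or> degree N' < degree d'"
  proof (cases "N' = 0")
    case False
    hence "Suc (degree N') = degree (N - Polynomial.smult c M)" unfolding N' by (subst degree_mult_eq) auto
    also have "\<dots> \<le> max (degree N) (degree (Polynomial.smult c M))" by (rule degree_diff_le_max)
    also have "\<dots> \<le> degree d'"
      using Suc.prems(6) degd \<open>degree M \<le> degree d'\<close> degree_smult_le[of c M] by auto
    finally show ?thesis by simp
  qed simp
  have "N' \<in> {f. [:-a, 1:] * f \<in> L}"
  proof (rule Suc.hyps(1)[of d'])
    show "k = degree d'" using degd Suc.hyps(2) by simp
    show "0 \<in> {f. [:-a, 1:] * f \<in> L}" using L(1) by simp
    show "f + g \<in> {f. [:-a, 1:] * f \<in> L}"
      if "f \<in> {f. [:-a, 1:] * f \<in> L}" "g \<in> {f. [:-a, 1:] * f \<in> L}" for f g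
      using L(2) that by (simp add: distrib_left del: mult_pCons_left)
    show "Polynomial.smult b f \<in> {f. [:-a, 1:] * f \<in> L}" if "f \<in> {f. [:-a, 1:] * f \<in> L}" for b f
      using L(3) that by (simp del: mult_pCons_left)
    show "f \<in> {f. [:-a, 1:] * f \<in> L}" if "d' = [:-b, 1:] ^ i * f" "i > 0" for b i f
    proof -
      have "d = [:-b, 1:] ^ i * ([:-a, 1:] * f)" unfolding d that(1) by (simp only: mult.left_commute)
      thus ?thesis using L(4) that(2) by blast
    qed
  qed (use d'0 degN' in auto)
  hence "[:-a, 1:] * N' + Polynomial.smult c M \<in> L" using L(2,3) M_in_L by blast
  moreover have "N = [:-a, 1:] * N' + Polynomial.smult c M" using N' by (metis diff_add_cancel)
  ultimately show ?case by simp
qed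

text \<open>This polynomial is the minimal polynomial of the Jordan matrix with the given blocks; only its roots
and their multiplicities matter below.\<close>

lemma exists_poly_with_block_orders:
  fixes n_as :: "(nat \<times> 'a :: field) list"
  shows "\<exists>d. monic d \<and> (\<forall>a. Polynomial.order a d = Max (insert 0 {k. (k, a) \<in> set n_as}))"
proof (induction n_as)
  case Nil
  show ?case by (intro exI[of _ 1]) simp
next
  case (Cons x n_as)
  obtain k b where x: "x = (k, b)" by fastforce
  obtain d where d: "monic d" "\<And>a. Polynomial.order a d = Max (insert 0 {k. (k, a) \<in> set n_as})"
    using Cons.IH by blast
  \<comment> \<open>The subtraction truncates: a block no larger than the previous ones for \<open>b\<close> changes nothing.\<close>
  define e where "e = [:-b, 1:] ^ (k - Polynomial.order b d)"
  have nz: "d \<noteq> 0" "e \<noteq> 0" using d(1) unfolding e_def by auto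
  have fin: "finite {k. (k, a) \<in> set n_as}" for a
    by (rule finite_subset[of _ "fst ` set n_as"]) force+
  have "monic (e * d)" unfolding e_def using d(1) by (intro monic_mult monic_power) auto
  moreover have "Polynomial.order a (e * d) = Max (insert 0 {k. (k, a) \<in> set (x # n_as)})" for a
  proof -
    have ord: "Polynomial.order a (e * d) = Polynomial.order a e + Polynomial.order a d"
      using nz by (simp add: order_mult)
    show ?thesis
    proof (cases "a = b")
      case True
      have "insert 0 {k. (k, a) \<in> set (x # n_as)} = insert k (insert 0 {k. (k, a) \<in> set n_as})"
        using x True by auto
      hence "Max (insert 0 {k. (k, a) \<in> set (x # n_as)}) = max k (Polynomial.order b d)"
        using d(2)[of a] fin[of a] True by simp
      moreover have "Polynomial.order a e = k - Polynomial.order b d"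
        unfolding e_def True by (rule order_power_n_n)
      ultimately show ?thesis using ord True by simp
    next
      case False
      have "Polynomial.order a e = 0" by (rule order_0I) (use False in \<open>simp add: e_def\<close>)
      moreover have "{k. (k, a) \<in> set (x # n_as)} = {k. (k, a) \<in> set n_as}" using x False by auto
      ultimately show ?thesis using ord d(2)[of a] by simp
    qed
  qed
  ultimately show ?case by blast
qed

section \<open>Resolvents of Jordan matrices\<close>

lemma char_poly_matrix_four_block_diag:
  assumes "A \<in> carrier_mat k k" and "D \<in> carrier_mat m m"
  shows "char_poly_matrix (four_block_mat A (0\<^sub>m k m) (0\<^sub>m m k) D) =
    four_block_mat (char_poly_matrix A) (0\<^sub>m k m) (0\<^sub>m m k) (char_poly_matrix D)"
  using assms by (intro eq_matI) (auto simp: char_poly_matrix_def)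

text \<open>The resolvent of a Jordan block of size \<open>k\<close> for \<open>a\<close> is its adjugate divided by
\<open>(t - a)\<^sup>k\<close>, so every common multiple \<open>d\<close> of these powers is a common denominator for all
blocks.\<close>

lemma jordan_matrix_annihilator:
  fixes n_as :: "(nat \<times> 'a :: field) list"
  assumes "\<And>k a. (k, a) \<in> set n_as \<Longrightarrow> [:-a, 1:] ^ k dvd d"
  defines "n \<equiv> sum_list (map fst n_as)"
  shows "\<exists>W \<in> carrier_mat n n. char_poly_matrix (jordan_matrix n_as) * W = d \<cdot>\<^sub>m 1\<^sub>m n"
  using assms(1) unfolding n_def
proof (induction n_as)
  case Nil
  show ?case by (intro bexI[of _ "0\<^sub>m 0 0"] eq_matI) (auto simp: char_poly_matrix_def)
next
  case (Cons x n_as)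
  obtain k a where x: "x = (k, a)" by fastforce
  let ?m = "sum_list (map fst n_as)"
  let ?J = "jordan_block k a" and ?R = "jordan_matrix n_as"
  have J: "?J \<in> carrier_mat k k" and R: "?R \<in> carrier_mat ?m ?m" by simp_all
  have MJ: "char_poly_matrix ?J \<in> carrier_mat k k" and MR: "char_poly_matrix ?R \<in> carrier_mat ?m ?m"
    using J R by (auto intro: char_poly_matrix_closed)
  obtain W2 where W2: "W2 \<in> carrier_mat ?m ?m" "char_poly_matrix ?R * W2 = d \<cdot>\<^sub>m 1\<^sub>m ?m"
    using Cons by auto
  obtain e where e: "d = [:-a, 1:] ^ k * e" using Cons.prems[of k a] x by (auto elim: dvdE)
  define W1 where "W1 = e \<cdot>\<^sub>m adj_mat (char_poly_matrix ?J)"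
  have W1: "W1 \<in> carrier_mat k k" unfolding W1_def using adj_mat(1)[OF MJ] by simp
  have "char_poly_matrix ?J * W1 = e \<cdot>\<^sub>m (det (char_poly_matrix ?J) \<cdot>\<^sub>m 1\<^sub>m k)"
    unfolding W1_def using adj_mat[OF MJ] MJ by (simp add: mult_smult_distrib[OF MJ])
  also have "det (char_poly_matrix ?J) = [:-a, 1:] ^ k"
    using jordan_block_char_poly[of k a] by (simp add: char_poly_def)
  finally have MW1: "char_poly_matrix ?J * W1 = d \<cdot>\<^sub>m 1\<^sub>m k"
    unfolding e by (auto intro!: eq_matI simp: mult_ac)
  let ?W = "four_block_mat W1 (0\<^sub>m k ?m) (0\<^sub>m ?m k) W2"
  have "char_poly_matrix (jordan_matrix (x # n_as)) * ?W =
    four_block_mat (char_poly_matrix ?J) (0\<^sub>m k ?m) (0\<^sub>m ?m k) (char_poly_matrix ?R) * ?W"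
    unfolding x jordan_matrix_Cons char_poly_matrix_four_block_diag[OF J R] ..
  also have "\<dots> = four_block_mat (d \<cdot>\<^sub>m 1\<^sub>m k) (0\<^sub>m k ?m) (0\<^sub>m ?m k) (d \<cdot>\<^sub>m 1\<^sub>m ?m)"
    using MJ MR W1 W2(1)
    by (subst mult_four_block_mat[OF MJ zero_carrier_mat zero_carrier_mat MR W1 zero_carrier_mat zero_carrier_mat W2(1)])
      (simp add: MW1 W2(2) right_mult_zero_mat[OF MJ] right_mult_zero_mat[OF MR])
  also have "\<dots> = d \<cdot>\<^sub>m 1\<^sub>m (k + ?m)" by (intro eq_matI) auto
  finally show ?case using four_block_carrier_mat[OF W1 W2(1)] x by auto
qed

text \<open>The last unit vector generates the space under the block, and its image under the resolvent lists
\<open>1 / (t - a)\<^sup>k\<close>, ..., \<open>1 / (t - a)\<close>, here multiplied by \<open>d\<close>.\<close>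

lemma jordan_block_cyclic:
  fixes a :: "'a :: field"
  assumes d: "d = [:-a, 1:] ^ k * e"
  shows "char_poly_matrix (jordan_block k a) *\<^sub>v vec k (\<lambda>i. [:-a, 1:] ^ i * e) =
    d \<cdot>\<^sub>v map_vec (\<lambda>c. [:c:]) (vec k (\<lambda>i. if Suc i = k then 1 else 0))" (is "?M *\<^sub>v ?w = ?rhs")
proof (rule eq_vecI)
  have M: "?M \<in> carrier_mat k k" by (rule char_poly_matrix_closed) simp
  show "dim_vec (?M *\<^sub>v ?w) = dim_vec ?rhs" using carrier_matD[OF M] by simp
  fix i assume "i < dim_vec ?rhs"
  hence i: "i < k" by simp
  have neg: "[:- 1:] * p = - p" for p :: "'a poly" by simp
  have "(?M *\<^sub>v ?w) $ i = (\<Sum>j<k. ?M $$ (i, j) * ([:-a, 1:] ^ j * e))"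
    using i carrier_matD[OF M] by (simp add: scalar_prod_def atLeast0LessThan)
  also have "\<dots> = (\<Sum>j<k. (if j = i then [:-a, 1:] ^ Suc j * e else 0) +
      (if j = Suc i then - ([:-a, 1:] ^ j * e) else 0))"
    using i by (intro sum.cong refl) (auto simp: char_poly_matrix_def neg simp del: mult_pCons_left)
  also have "\<dots> = [:-a, 1:] ^ Suc i * e + (if Suc i < k then - ([:-a, 1:] ^ Suc i * e) else 0)"
    using i by (simp add: sum.distrib del: mult_pCons_left power_Suc)
  also have "\<dots> = (if Suc i = k then d else 0)" using i d by (cases "Suc i = k") auto
  finally show "(?M *\<^sub>v ?w) $ i = ?rhs $ i" using i by simp
qed

text \<open>Stacking the columns of the single blocks. One vector \<open>u\<close> serves all blocks, including the smaller
ones for the same eigenvalue, whose entries in \<open>w\<close> merely repeat entries of the larger ones.\<close>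

lemma jordan_matrix_cyclic:
  fixes n_as :: "(nat \<times> 'a :: field) list"
  assumes "\<And>k a. (k, a) \<in> set n_as \<Longrightarrow> [:-a, 1:] ^ k dvd d"
  defines "n \<equiv> sum_list (map fst n_as)"
  shows "\<exists>u \<in> carrier_vec n. \<exists>w \<in> carrier_vec n.
    char_poly_matrix (jordan_matrix n_as) *\<^sub>v w = d \<cdot>\<^sub>v map_vec (\<lambda>c. [:c:]) u \<and>
    (\<forall>k a i f. (k, a) \<in> set n_as \<longrightarrow> 0 < i \<longrightarrow> i \<le> k \<longrightarrow> d = [:-a, 1:] ^ i * f \<longrightarrow>
      (\<exists>r < n. w $ r = f))"
  using assms(1) unfolding n_def
proof (induction n_as)
  case Nil
  show ?case by (intro bexI[of _ "0\<^sub>v 0"] conjI eq_vecI) (auto simp: char_poly_matrix_def)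
next
  case (Cons x n_as)
  obtain k a where x: "x = (k, a)" by fastforce
  let ?m = "sum_list (map fst n_as)"
  let ?J = "jordan_block k a" and ?R = "jordan_matrix n_as"
  have J: "?J \<in> carrier_mat k k" and R: "?R \<in> carrier_mat ?m ?m" by simp_all
  have MJ: "char_poly_matrix ?J \<in> carrier_mat k k" and MR: "char_poly_matrix ?R \<in> carrier_mat ?m ?m"
    using J R by (auto intro: char_poly_matrix_closed)
  obtain u2 w2 where u2: "u2 \<in> carrier_vec ?m" and w2: "w2 \<in> carrier_vec ?m"
    and Mw2: "char_poly_matrix ?R *\<^sub>v w2 = d \<cdot>\<^sub>v map_vec (\<lambda>c. [:c:]) u2"
    and ent2: "\<And>k a i f. (k, a) \<in> set n_as \<Longrightarrow> 0 < i \<Longrightarrow> i \<le> k \<Longrightarrow> d = [:-a, 1:] ^ i * f \<Longrightarrow>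
      \<exists>r < ?m. w2 $ r = f"
    using Cons by (metis list.set_intros(2))
  obtain e where e: "d = [:-a, 1:] ^ k * e" using Cons.prems[of k a] x by (auto elim: dvdE)
  define w1 where "w1 = vec k (\<lambda>i. [:-a, 1:] ^ i * e)"
  define u1 where "u1 = vec k (\<lambda>i. if Suc i = k then 1 else (0 :: 'a))"
  have w1: "w1 \<in> carrier_vec k" and u1: "u1 \<in> carrier_vec k" unfolding w1_def u1_def by simp_all
  have "char_poly_matrix (jordan_matrix (x # n_as)) *\<^sub>v (w1 @\<^sub>v w2) =
    char_poly_matrix ?J *\<^sub>v w1 @\<^sub>v char_poly_matrix ?R *\<^sub>v w2"
    unfolding x jordan_matrix_Cons char_poly_matrix_four_block_diag[OF J R]
    by (rule mult_mat_vec_split[OF MJ MR w1 w2])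
  also have "char_poly_matrix ?J *\<^sub>v w1 = d \<cdot>\<^sub>v map_vec (\<lambda>c. [:c:]) u1"
    unfolding w1_def u1_def by (rule jordan_block_cyclic[OF e])
  also have "d \<cdot>\<^sub>v map_vec (\<lambda>c. [:c:]) u1 @\<^sub>v char_poly_matrix ?R *\<^sub>v w2 =
    d \<cdot>\<^sub>v map_vec (\<lambda>c. [:c:]) (u1 @\<^sub>v u2)"
    unfolding Mw2 using u1 u2 by (intro eq_vecI) auto
  finally have Mw: "char_poly_matrix (jordan_matrix (x # n_as)) *\<^sub>v (w1 @\<^sub>v w2) =
    d \<cdot>\<^sub>v map_vec (\<lambda>c. [:c:]) (u1 @\<^sub>v u2)" .
  have ent: "\<exists>r < k + ?m. (w1 @\<^sub>v w2) $ r = f"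
    if mem: "(l, b) \<in> set (x # n_as)" and i: "0 < i" "i \<le> l" and f: "d = [:-b, 1:] ^ i * f" for l b i f
  proof (cases "(l, b) = x")
    case True
    have "[:-a, 1:] ^ i * f = [:-a, 1:] ^ i * ([:-a, 1:] ^ (k - i) * e)"
      using e f i True x by (simp add: mult.assoc[symmetric] power_add[symmetric])
    \<comment> \<open>Position \<open>j\<close> of the block holds \<open>d\<close> divided by the power \<open>k - j\<close> of \<open>t - a\<close>.\<close>
    hence "f = w1 $ (k - i)" using i True x by (simp add: w1_def)
    thus ?thesis using i True x w1 w2 by (intro exI[of _ "k - i"]) auto
  next
    case False
    then obtain r where "r < ?m" "w2 $ r = f" using ent2[of l b i f] mem i f by auto
    thus ?thesis using w1 w2 by (intro exI[of _ "k + r"]) auto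
  qed
  show ?case
  proof (intro bexI conjI allI impI)
    show "u1 @\<^sub>v u2 \<in> carrier_vec (sum_list (map fst (x # n_as)))"
      "w1 @\<^sub>v w2 \<in> carrier_vec (sum_list (map fst (x # n_as)))"
      using u1 u2 w1 w2 x by auto
  qed (use Mw ent x in auto)
qed

section \<open>Rank one perturbations of Jordan matrices\<close>

text \<open>The characteristic polynomial of \<open>J\<close> divides \<open>d\<close> times that of the perturbed matrix, because \<open>d\<close>
clears the denominators of the resolvent of \<open>J\<close>.\<close>

lemma order_le_of_jordan_perturbation:
  fixes n_as :: "(nat \<times> 'a :: field) list"
  defines "n \<equiv> sum_list (map fst n_as)" and "J \<equiv> jordan_matrix n_as"
  assumes d: "d \<noteq> 0" "\<And>k a. (k, a) \<in> set n_as \<Longrightarrow> [:-a, 1:] ^ k dvd d"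
    and B: "B \<in> carrier_mat n n" "vec_space.rank n B = 1"
    and q0: "char_poly (J + B) \<noteq> 0"
  shows "Polynomial.order a (char_poly J) \<le> Polynomial.order a d + Polynomial.order a (char_poly (J + B))"
proof -
  let ?c = "\<lambda>c :: 'a. [:c:]"
  have J: "J \<in> carrier_mat n n" unfolding J_def n_def by simp
  note M = char_poly_matrix_closed[OF J]
  obtain W where W: "W \<in> carrier_mat n n" "char_poly_matrix J * W = d \<cdot>\<^sub>m 1\<^sub>m n"
    using jordan_matrix_annihilator[OF d(2)] unfolding J_def n_def by blast
  from B(2)[unfolded rank_eq_1_iff[OF B(1)]]
  obtain u v where uv: "u \<in> carrier_mat n 1" "v \<in> carrier_mat 1 n" "B = u * v" by blast
  have u': "map_mat ?c u \<in> carrier_mat n 1" using uv by simp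
  have w: "W * map_mat ?c u \<in> carrier_mat n 1" using W(1) u' by simp
  have "char_poly_matrix J * (W * map_mat ?c u) = d \<cdot>\<^sub>m 1\<^sub>m n * map_mat ?c u"
    unfolding W(2)[symmetric] by (rule assoc_mult_mat[OF M W(1) u', symmetric])
  also have "\<dots> = d \<cdot>\<^sub>m map_mat ?c u"
    using u' by (simp add: mult_smult_assoc_mat[OF one_carrier_mat u'])
  finally have "d * char_poly (J + B) =
      char_poly J * (d - (map_mat ?c v * (W * map_mat ?c u)) $$ (0, 0))"
    unfolding uv(3) by (rule char_poly_rank_one_perturbation[OF J uv(1,2) w])
  hence "char_poly J dvd d * char_poly (J + B)" by simp
  hence "Polynomial.order a (char_poly J) \<le> Polynomial.order a (d * char_poly (J + B))"
    using d(1) q0 by (intro dvd_imp_order_le) auto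
  thus ?thesis using d(1) q0 by (simp add: order_mult)
qed

text \<open>With the column \<open>u\<close> fixed, the row \<open>v\<close> picks an arbitrary linear combination \<open>N\<close> of the entries of the
resolvent column \<open>w\<close>. Under the assumption on block sizes, these entries include every quotient
of \<open>d\<close> by a power of a linear factor.\<close>

lemma jordan_perturbation_realizes:
  fixes n_as :: "(nat \<times> 'a :: alg_closed_field) list"
  defines "n \<equiv> sum_list (map fst n_as)" and "J \<equiv> jordan_matrix n_as"
  assumes d: "d \<noteq> 0" "\<And>k a. (k, a) \<in> set n_as \<Longrightarrow> [:-a, 1:] ^ k dvd d"
    and blocks: "\<And>a. Polynomial.order a d > 0 \<Longrightarrow> (Polynomial.order a d, a) \<in> set n_as"
    and N: "N = 0 \<or> degree N < degree d"
  shows "\<exists>u \<in> carrier_mat n 1. \<exists>v \<in> carrier_mat 1 n.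
    d * char_poly (J + u * v) = char_poly J * (d - N)"
proof -
  let ?c = "\<lambda>c :: 'a. [:c:]"
  have J: "J \<in> carrier_mat n n" unfolding J_def n_def by simp
  note M = char_poly_matrix_closed[OF J]
  obtain u w where uw: "u \<in> carrier_vec n" "w \<in> carrier_vec n"
    and Mw: "char_poly_matrix J *\<^sub>v w = d \<cdot>\<^sub>v map_vec ?c u"
    and entries: "\<And>k a i f. (k, a) \<in> set n_as \<Longrightarrow> 0 < i \<Longrightarrow> i \<le> k \<Longrightarrow> d = [:-a, 1:] ^ i * f \<Longrightarrow>
      \<exists>r < n. w $ r = f"
    using jordan_matrix_cyclic[OF d(2)] unfolding J_def n_def by blast
  define U where "U = mat_of_cols n [u]"
  define X where "X = mat_of_cols n [w]"
  have U: "U \<in> carrier_mat n 1" and X: "X \<in> carrier_mat n 1" unfolding U_def X_def by auto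
  have MX: "char_poly_matrix J * X = d \<cdot>\<^sub>m map_mat ?c U"
  proof (rule eq_matI)
    fix i j assume "i < dim_row (d \<cdot>\<^sub>m map_mat ?c U)" "j < dim_col (d \<cdot>\<^sub>m map_mat ?c U)"
    hence ij: "i < n" "j = 0" unfolding U_def by auto
    have "(char_poly_matrix J * X) $$ (i, j) = (char_poly_matrix J *\<^sub>v w) $ i"
      using ij carrier_matD[OF M] uw(2) unfolding X_def by simp
    also have "\<dots> = (d \<cdot>\<^sub>m map_mat ?c U) $$ (i, j)"
      unfolding Mw U_def using ij uw(1) by (simp add: mat_of_cols_def)
    finally show "(char_poly_matrix J * X) $$ (i, j) = (d \<cdot>\<^sub>m map_mat ?c U) $$ (i, j)" .
  qed (use M U X in auto)
  define L where "L = {(\<Sum>r<n. [:g r:] * w $ r) | g. True}"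
  have "N \<in> L"
  proof (rule partial_fractions_span[OF d(1) _ _ _ _ N])
    show "0 \<in> L" unfolding L_def by (auto intro!: exI[of _ "\<lambda>_. 0"])
    fix f g assume "f \<in> L" "g \<in> L"
    then obtain x y where "f = (\<Sum>r<n. [:x r:] * w $ r)" "g = (\<Sum>r<n. [:y r:] * w $ r)"
      unfolding L_def by blast
    hence "f + g = (\<Sum>r<n. [:x r + y r:] * w $ r)"
      by (simp add: sum.distrib smult_add_left)
    thus "f + g \<in> L" unfolding L_def by (auto intro!: exI[of _ "\<lambda>r. x r + y r"])
  next
    fix b f assume "f \<in> L"
    then obtain x where "f = (\<Sum>r<n. [:x r:] * w $ r)" unfolding L_def by blast
    hence "Polynomial.smult b f = (\<Sum>r<n. [:b * x r:] * w $ r)" by (simp add: smult_sum2)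
    thus "Polynomial.smult b f \<in> L" unfolding L_def by (auto intro!: exI[of _ "\<lambda>r. b * x r"])
  next
    fix a i f assume f: "d = [:-a, 1:] ^ i * f" and i: "i > 0"
    have "i \<le> Polynomial.order a d" using f d(1) by (metis dvd_triv_left order_divides)
    then obtain r where r: "r < n" "w $ r = f" using entries[OF blocks i _ f] i by auto
    have "(\<Sum>s<n. [:if s = r then 1 else 0:] * w $ s) = (\<Sum>s<n. if s = r then w $ s else 0)"
      by (intro sum.cong) auto
    also have "\<dots> = f" using r by simp
    finally show "f \<in> L" unfolding L_def by (auto intro!: exI[of _ "\<lambda>s. if s = r then 1 else 0"])
  qed
  then obtain g where g: "N = (\<Sum>r<n. [:g r:] * w $ r)" unfolding L_def by blast
  define V where "V = mat 1 n (\<lambda>(i, r). g r)"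
  have V: "V \<in> carrier_mat 1 n" unfolding V_def by simp
  have "(map_mat ?c V * X) $$ (0, 0) = N"
    using uw(2) unfolding V_def X_def g by (simp add: scalar_prod_def atLeast0LessThan)
  with char_poly_rank_one_perturbation[OF J U V X MX]
  have "d * char_poly (J + U * V) = char_poly J * (d - N)" by simp
  thus ?thesis using U V by blast
qed

text \<open>An extra entry at position (0, 1), above the diagonal, leaves the diagonal of the triangular matrix
unchanged.\<close>

lemma rank_one_perturbation_same_char_poly:
  fixes n_as :: "(nat \<times> 'a :: field) list"
  defines "n \<equiv> sum_list (map fst n_as)" and "J \<equiv> jordan_matrix n_as"
  assumes n: "n \<ge> 2"
  shows "\<exists>B \<in> carrier_mat n n. vec_space.rank n B = 1 \<and> char_poly (J + B) = char_poly J"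
proof -
  have J: "J \<in> carrier_mat n n" unfolding J_def n_def by simp
  have ut: "upper_triangular J"
    unfolding J_def upper_triangular_def using jordan_matrix_upper_triangular by auto
  define u :: "'a mat" where "u = mat n 1 (\<lambda>(i, j). if i = 0 then 1 else 0)"
  define v :: "'a mat" where "v = mat 1 n (\<lambda>(i, j). if j = 1 then 1 else 0)"
  have uv: "u \<in> carrier_mat n 1" "v \<in> carrier_mat 1 n" unfolding u_def v_def by simp_all
  have entry: "(u * v) $$ (i, j) = (if i = 0 \<and> j = 1 then 1 else 0)" if "i < n" "j < n" for i j
    using that unfolding u_def v_def by (simp add: scalar_prod_def)
  have B: "u * v \<in> carrier_mat n n" using uv by simp
  have "u * v \<noteq> 0\<^sub>m n n" using entry[of 0 1] n by auto
  hence "vec_space.rank n (u * v) = 1" unfolding rank_eq_1_iff[OF B] using uv by blast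
  moreover have "upper_triangular (J + u * v)"
  proof (rule upper_triangularI)
    fix i j assume "j < i" "i < dim_row (J + u * v)"
    thus "(J + u * v) $$ (i, j) = 0"
      using upper_triangularD[OF ut, of j i] entry[of i j] J uv by simp
  qed
  moreover have "diag_mat (J + u * v) = diag_mat J"
    unfolding diag_mat_def using J uv entry by (auto simp: u_def)
  ultimately show ?thesis
    using char_poly_upper_triangular[OF J ut] char_poly_upper_triangular[of "J + u * v" n] B J
    by (intro bexI[of _ "u * v"]) auto
qed

theorem theorem2:
  fixes A :: "'a::alg_closed_field mat" and q :: "'a poly" and n :: nat
  assumes "n \<ge> 1"
    and "A \<in> carrier_mat n n"
    and "monic q" and "degree q = n"
    and "n = 1 \<Longrightarrow> q \<noteq> char_poly A"
  shows "(\<exists>B \<in> carrier_mat n n. vec_space.rank n B = 1 \<and> char_poly (A + B) = q) \<longleftrightarrow>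
    (\<forall>\<mu>. int (Polynomial.order \<mu> q) \<ge> int (alg_mult \<mu> A) - int (max_jordan_block \<mu> A))"
proof -
  obtain n_as where jnf: "jordan_nf A n_as" using jordan_nf_exists_alg_closed[OF assms(2)] by blast
  define J where "J = jordan_matrix n_as"
  have sim: "similar_mat A J" using jnf unfolding jordan_nf_def J_def by blast
  have "J \<in> carrier_mat n n" using similar_matD[OF sim] assms(2) by auto
  hence n: "n = sum_list (map fst n_as)" unfolding J_def by (metis carrier_matD(1) jordan_matrix_dim(1))
  have J: "J \<in> carrier_mat n n" unfolding J_def n by simp
  let ?p = "char_poly J"
  have pA: "char_poly A = ?p" by (rule char_poly_similar[OF sim])
  have p: "degree ?p = n" "monic ?p" using degree_monic_char_poly[OF J] by auto
  obtain d where d: "monic d"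
    and ord_d: "\<And>a. Polynomial.order a d = Max (insert 0 {k. (k, a) \<in> set n_as})"
    using exists_poly_with_block_orders by blast
  have fin: "finite {k. (k, a) \<in> set n_as}" for a
    by (rule finite_subset[of _ "fst ` set n_as"]) force+
  have d0: "d \<noteq> 0" using d by auto
  have block_dvd: "[:-a, 1:] ^ k dvd d" if "(k, a) \<in> set n_as" for k a
  proof -
    have "k \<le> Polynomial.order a d" unfolding ord_d using fin[of a] that by (intro Max_ge) auto
    thus ?thesis by (simp add: order_divides)
  qed
  have block_mem: "(Polynomial.order a d, a) \<in> set n_as" if "Polynomial.order a d > 0" for a
  proof -
    have "Polynomial.order a d \<in> insert 0 {k. (k, a) \<in> set n_as}"
      unfolding ord_d using fin[of a] by (intro Max_in) auto
    thus ?thesis using that by auto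
  qed
  have cond: "int (Polynomial.order a q) \<ge> int (alg_mult a A) - int (max_jordan_block a A) \<longleftrightarrow>
      Polynomial.order a ?p \<le> Polynomial.order a d + Polynomial.order a q" for a
    unfolding alg_mult_def max_jordan_block_eq[OF jnf] pA ord_d[of a] by linarith
  have q0: "q \<noteq> 0" using assms(3) by auto
  have similar_iff: "(\<exists>B \<in> carrier_mat n n. vec_space.rank n B = 1 \<and> char_poly (A + B) = q) \<longleftrightarrow>
      (\<exists>B \<in> carrier_mat n n. vec_space.rank n B = 1 \<and> char_poly (J + B) = q)"
    using rank_one_perturbation_similar[OF assms(2) sim]
      rank_one_perturbation_similar[OF J similar_mat_sym[OF sim]] by metis
  show ?thesis unfolding similar_iff cond
  proof (intro iffI allI)
    fix a
    assume "\<exists>B \<in> carrier_mat n n. vec_space.rank n B = 1 \<and> char_poly (J + B) = q"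
    then obtain B where B: "B \<in> carrier_mat n n" "vec_space.rank n B = 1" "char_poly (J + B) = q"
      by blast
    show "Polynomial.order a ?p \<le> Polynomial.order a d + Polynomial.order a q"
      using order_le_of_jordan_perturbation[of d n_as B a] d0 block_dvd B q0
      unfolding J_def n by blast
  next
    assume ord: "\<forall>a. Polynomial.order a ?p \<le> Polynomial.order a d + Polynomial.order a q"
    show "\<exists>B \<in> carrier_mat n n. vec_space.rank n B = 1 \<and> char_poly (J + B) = q"
    proof (cases "q = ?p")
      case True
      hence "n \<ge> 2" using assms(1,5) pA by (cases "n = 1") auto
      thus ?thesis using rank_one_perturbation_same_char_poly[of n_as] True unfolding J_def n by auto
    next
      case False
      have "d dvd ?p"
      proof (rule dvd_if_order_le[OF d0])
        fix a
        show "Polynomial.order a d \<le> Polynomial.order a ?p"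
        proof (cases "Polynomial.order a d > 0")
          case True
          let ?f = "\<lambda>(k, a). [:- a, 1:] ^ k"
          have "?f (Polynomial.order a d, a) \<in> set (map ?f n_as)"
            using imageI[OF block_mem[OF True], of ?f] by (simp del: split_conv)
          hence "[:- a, 1:] ^ Polynomial.order a d dvd ?p"
            unfolding J_def jordan_matrix_char_poly using prod_list_dvd by fastforce
          thus ?thesis using p(2) by (auto simp: order_divides)
        qed simp
      qed
      then obtain h where h: "?p = d * h" by (elim dvdE)
      have h0: "h \<noteq> 0" using h p(2) by auto
      have "h dvd q"
        using ord h0 d0 by (intro dvd_if_order_le) (auto simp: h order_mult)
      then obtain g where g: "q = h * g" by (elim dvdE)
      have g0: "g \<noteq> 0" using g q0 by auto
      have deg: "degree g = degree d"
        using p(1) assms(4) h0 g0 d0 unfolding h g by (simp add: degree_mult_eq)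
      have "lead_coeff h = 1" using p(2) d unfolding h by (simp add: lead_coeff_mult)
      hence "monic g" using assms(3) unfolding g by (simp add: lead_coeff_mult)
      have "d - g = 0 \<or> degree (d - g) < degree d"
      proof (cases "degree d")
        case 0
        hence "d = 1" "g = 1"
          using monic_degree_0[OF d] monic_degree_0[OF \<open>monic g\<close>] deg by simp_all
        thus ?thesis by simp
      next
        case (Suc m)
        have "degree (d - g) \<le> m"
        proof (rule degree_le, intro allI impI)
          fix i assume "m < i"
          hence "i = degree d \<or> i > degree d" using Suc by auto
          thus "coeff (d - g) i = 0"
            using d \<open>monic g\<close> deg by (auto simp: coeff_eq_0)
        qed
        thus ?thesis using Suc by simp
      qed
      then obtain u v where uv: "u \<in> carrier_mat n 1" "v \<in> carrier_mat 1 n"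
        and eq: "d * char_poly (J + u * v) = ?p * (d - (d - g))"
        using jordan_perturbation_realizes[OF d0 block_dvd block_mem, of "d - g"]
        unfolding J_def n by blast
      have "d * char_poly (J + u * v) = d * q" unfolding eq g unfolding h by (simp add: mult_ac)
      hence q: "char_poly (J + u * v) = q" using d0 by simp
      have B: "u * v \<in> carrier_mat n n" using uv by simp
      \<comment> \<open>A zero perturbation would leave the characteristic polynomial at \<open>?p \<noteq> q\<close>.\<close>
      have "u * v \<noteq> 0\<^sub>m n n" using q False J by auto
      hence "vec_space.rank n (u * v) = 1" unfolding rank_eq_1_iff[OF B] using uv by blast
      thus ?thesis using B q by blast
    qed
  qed
qed

end
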